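(* Let $G$ be a finite group and let $\chi,\psi\in\operatorname{Irr}(G)$. If $\gcd(\chi(1),\psi(1))=1$, then $$\operatorname{dl}\big(\operatorname{Ker}(\alpha)/\operatorname{Ker}(\chi\psi)\big)\leq 1$$ for any irreducible constituent $\alpha$ of the product $\chi\psi$.
   Context: All characters are complex characters of finite groups, and $\operatorname{Irr}(G)$ is the set of irreducible complex characters of $G$. For $\chi,\psi\in\operatorname{Irr}(G)$, $\chi\psi$ is the pointwise product character. $\operatorname{Ker}(\cdot)$ denotes the kernel of a character, and $\operatorname{dl}(H)$ denotes the derived length of a group $H$ (so $\operatorname{dl}(H)\leq 1$ means that $H$ is solvable of derived length at most $1$, i.e. abelian). For every irreducible constituent $\alpha$ of $\chi\psi$ one has $\operatorname{Ker}(\chi\psi)\subseteq\operatorname{Ker}(\alpha)$. *)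

theory Defs
  imports
    "HOL-Algebra.Algebra"
    "HOL-Library.Extended_Nat"
    "Jordan_Normal_Form.VS_Connect"
begin

definition general_linear :: "nat \<Rightarrow> complex mat monoid" where
  "general_linear n = units_of (ring_mat TYPE(complex) n ())"

definition representation ::
    "('a, 'b) monoid_scheme \<Rightarrow> nat \<Rightarrow> ('a \<Rightarrow> complex mat) \<Rightarrow> bool" where
  "representation G n \<rho> \<longleftrightarrow> n > 0 \<and> \<rho> \<in> hom G (general_linear n)"

definition irreducible_representation ::
    "('a, 'b) monoid_scheme \<Rightarrow> nat \<Rightarrow> ('a \<Rightarrow> complex mat) \<Rightarrow> bool" where
  "irreducible_representation G n \<rho> \<longleftrightarrow> representation G n \<rho> \<and>
    (\<forall>W. VectorSpace.subspace class_ring W (module_vec TYPE(complex) n) \<and>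
          (\<forall>g \<in> carrier G. \<forall>w \<in> W. \<rho> g *\<^sub>v w \<in> W)
      \<longrightarrow> W = {0\<^sub>v n} \<or> W = carrier_vec n)"

definition mat_trace :: "'a :: comm_monoid_add mat \<Rightarrow> 'a" where
  "mat_trace A = (\<Sum>i<dim_row A. A $$ (i, i))"

text \<open>Characters are total functions, normalised to vanish outside \<^term>\<open>carrier G\<close>. Thus two
  characters agreeing on the group are equal, and pointwise sums, differences and products
  can be formed without restricting them to the carrier again.\<close>

definition afforded_character ::
    "('a, 'b) monoid_scheme \<Rightarrow> ('a \<Rightarrow> complex mat) \<Rightarrow> 'a \<Rightarrow> complex" where
  "afforded_character G \<rho> = (\<lambda>g. if g \<in> carrier G then mat_trace (\<rho> g) else 0)"

definition characters :: "('a, 'b) monoid_scheme \<Rightarrow> ('a \<Rightarrow> complex) set" where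
  "characters G = {afforded_character G \<rho> | n \<rho>. representation G n \<rho>}"

definition Irr :: "('a, 'b) monoid_scheme \<Rightarrow> ('a \<Rightarrow> complex) set" where
  "Irr G = {afforded_character G \<rho> | n \<rho>. irreducible_representation G n \<rho>}"

definition char_degree :: "('a, 'b) monoid_scheme \<Rightarrow> ('a \<Rightarrow> complex) \<Rightarrow> nat" where
  "char_degree G \<chi> = (THE n. \<chi> \<one>\<^bsub>G\<^esub> = of_nat n)"

definition char_kernel :: "('a, 'b) monoid_scheme \<Rightarrow> ('a \<Rightarrow> complex) \<Rightarrow> 'a set" where
  "char_kernel G \<chi> = {g \<in> carrier G. \<chi> g = \<chi> \<one>\<^bsub>G\<^esub>}"

definition irreducible_constituents ::
    "('a, 'b) monoid_scheme \<Rightarrow> ('a \<Rightarrow> complex) \<Rightarrow> ('a \<Rightarrow> complex) set" where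
  "irreducible_constituents G \<chi> =
    {\<alpha> \<in> Irr G. (\<lambda>g. \<chi> g - \<alpha> g) \<in> characters G \<or> \<chi> = \<alpha>}"

text \<open>The derived length is \<^term>\<open>\<infinity> :: enat\<close>, the infimum of the empty set, exactly when
  the derived series never reaches the trivial subgroup, i.e. when the group is not solvable.\<close>

definition derived_length :: "('a, 'b) monoid_scheme \<Rightarrow> enat" where
  "derived_length G = (INF n \<in> {n. (derived G ^^ n) (carrier G) = {\<one>\<^bsub>G\<^esub>}}. enat n)"

lemma representation_one:
  assumes "group G" "representation G n \<rho>"
  shows "\<rho> \<one>\<^bsub>G\<^esub> = 1\<^sub>m n"
proof -
  interpret R: ring "ring_mat TYPE(complex) n ()"
    by (rule ring_mat)
  have "group (general_linear n)"
    unfolding general_linear_def by (rule R.units_group)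
  moreover have "\<rho> \<in> hom G (general_linear n)"
    using assms(2) by (simp add: representation_def)
  ultimately have "\<rho> \<one>\<^bsub>G\<^esub> = \<one>\<^bsub>general_linear n\<^esub>"
    using assms(1) hom_one by blast
  then show ?thesis
    by (simp add: general_linear_def units_of_def ring_mat_def)
qed

lemma of_nat_char_degree:
  assumes "group G" "\<chi> \<in> characters G"
  shows "of_nat (char_degree G \<chi>) = \<chi> \<one>\<^bsub>G\<^esub>"
proof -
  obtain n \<rho> where rep: "representation G n \<rho>" and \<chi>: "\<chi> = afforded_character G \<rho>"
    using assms(2) unfolding characters_def by blast
  have "\<chi> \<one>\<^bsub>G\<^esub> = of_nat n"
    using assms(1) by (simp add: \<chi> afforded_character_def representation_one[OF assms(1) rep]
        mat_trace_def group.is_monoid monoid.one_closed)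
  then show ?thesis
    unfolding char_degree_def by simp
qed

lemma Irr_subset_characters: "Irr G \<subseteq> characters G"
  unfolding Irr_def characters_def irreducible_representation_def by blast

lemma derived_length_finite_iff:
  assumes "group G"
  shows "derived_length G < \<infinity> \<longleftrightarrow> solvable G"
proof -
  have "derived_length G < \<infinity> \<longleftrightarrow> (\<exists>n. (derived G ^^ n) (carrier G) = {\<one>\<^bsub>G\<^esub>})"
    unfolding derived_length_def INF_less_iff by auto
  then show ?thesis
    using group.solvable_iff_trivial_derived_seq[OF assms] by simp
qed

end

theory Submission
  imports Defs "Jordan_Normal_Form.Spectral_Radius"
begin

text \<open>Let \<open>H = Ker(\<alpha>)\<close>. Since \<open>\<alpha>\<close> is a constituent of \<open>\<chi>\<psi>\<close>, the trivial character of \<open>H\<close> occurs in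
  \<open>\<chi>\<psi>\<close>, which gives a nonzero \<open>H\<close>-intertwiner between the representation of \<open>\<chi>\<close> and the dual of that
  of \<open>\<psi>\<close>. With Schur's lemma for \<open>G\<close> it follows that \<open>\<chi>(y)/\<chi>(1) = \<psi>(y\<inverse>)/\<psi>(1) =: \<omega>(y)\<close> on \<open>H\<close>.
  Put \<open>c = [\<omega>,\<omega>]\<close>, the inner product on \<open>H\<close>. Then \<open>c \<chi>(1)\<^sup>2\<close> and \<open>c \<psi>(1)\<^sup>2\<close> are the
  natural numbers \<open>[\<chi>,\<chi>]\<close> and \<open>[\<psi>,\<psi>]\<close>, so \<open>c\<close> is a natural number by coprimality. As
  \<open>|\<omega>| \<le> 1\<close> and \<open>c \<noteq> 0\<close>, this forces \<open>c = 1\<close>, hence \<open>\<omega>(y) \<omega>(y\<inverse>) = 1\<close> for all \<open>y\<close> in \<open>H\<close>, that is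
  \<open>\<chi>\<psi>\<close> takes the value \<open>\<chi>(1)\<psi>(1)\<close> on \<open>H\<close>. So even \<open>Ker(\<alpha>) = Ker(\<chi>\<psi>)\<close>.\<close>

subsection \<open>Traces and sums of matrices\<close>

lemma mult_mat_index_sum:
  assumes "A \<in> carrier_mat n m" "B \<in> carrier_mat m p" "i < n" "j < p"
  shows "(A * B) $$ (i, j) = (\<Sum>k<m. A $$ (i, k) * B $$ (k, j))"
  using assms by (simp add: scalar_prod_def atLeast0LessThan)

lemma mat_trace_mult_comm:
  fixes A B :: "'a :: comm_semiring_0 mat"
  assumes "A \<in> carrier_mat n m" "B \<in> carrier_mat m n"
  shows "mat_trace (A * B) = mat_trace (B * A)"
proof -
  have "mat_trace (A * B) = (\<Sum>i<n. \<Sum>k<m. A $$ (i, k) * B $$ (k, i))"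
    using assms by (simp add: mat_trace_def mult_mat_index_sum[OF assms] del: index_mult_mat(1))
  also have "\<dots> = (\<Sum>k<m. \<Sum>i<n. B $$ (k, i) * A $$ (i, k))"
    by (subst sum.swap) (simp add: mult.commute)
  also have "\<dots> = mat_trace (B * A)"
    using assms by (simp add: mat_trace_def mult_mat_index_sum[OF assms(2,1)] del: index_mult_mat(1))
  finally show ?thesis .
qed

lemma mat_trace_similar:
  fixes A B :: "'a :: comm_ring_1 mat"
  assumes "similar_mat A B"
  shows "mat_trace A = mat_trace B"
proof -
  obtain n P Q where c: "{A, B, P, Q} \<subseteq> carrier_mat n n" and "Q * P = 1\<^sub>m n" "A = P * B * Q"
    using similar_matD[OF assms] by blast
  then have "mat_trace A = mat_trace (Q * (P * B))"
    using mat_trace_mult_comm[of "P * B" n n Q] by auto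
  also have "Q * (P * B) = B"
    using c \<open>Q * P = 1\<^sub>m n\<close> assoc_mult_mat[of Q n n P n B n] by auto
  finally show ?thesis .
qed

section \<open>Triangular form and traces of idempotents\<close>

lemma upper_triangular_mult:
  fixes A B :: "'a :: semiring_0 mat"
  assumes "A \<in> carrier_mat n n" "B \<in> carrier_mat n n" "upper_triangular A" "upper_triangular B"
  shows "upper_triangular (A * B)"
    and "i < n \<Longrightarrow> (A * B) $$ (i, i) = A $$ (i, i) * B $$ (i, i)"
proof -
  \<comment> \<open>One vanishing statement serves both claims: for \<open>k < i\<close> the factor
    from \<open>A\<close> is zero, and in the remaining cases \<open>j < k\<close>, so the factor
    from \<open>B\<close> is zero.\<close>
  have entry: "A $$ (i, k) * B $$ (k, j) = 0" if "i < n" "k < n" "k \<noteq> i \<or> j < i" "j \<le> i" for i j k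
    using that assms upper_triangularD[OF assms(3), of k i] upper_triangularD[OF assms(4), of j k]
    by (cases "k < i") auto
  show "upper_triangular (A * B)"
  proof (rule upper_triangularI)
    fix i j assume ij: "j < i" "i < dim_row (A * B)"
    then have "(A * B) $$ (i, j) = (\<Sum>k<n. A $$ (i, k) * B $$ (k, j))"
      using assms by (intro mult_mat_index_sum[where n = n and p = n]) auto
    also have "\<dots> = 0"
      using ij assms by (intro sum.neutral ballI entry) auto
    finally show "(A * B) $$ (i, j) = 0" .
  qed
  assume i: "i < n"
  have "(A * B) $$ (i, i) = (\<Sum>k<n. A $$ (i, k) * B $$ (k, i))"
    using assms i by (intro mult_mat_index_sum[where n = n and p = n]) auto
  also have "\<dots> = (\<Sum>k\<in>{i}. A $$ (i, k) * B $$ (k, i))"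
    using i entry by (intro sum.mono_neutral_right) auto
  finally show "(A * B) $$ (i, i) = A $$ (i, i) * B $$ (i, i)" by simp
qed

lemma upper_triangular_pow:
  fixes A :: "'a :: comm_semiring_1 mat"
  assumes "A \<in> carrier_mat n n" "upper_triangular A"
  shows "upper_triangular (A ^\<^sub>m k) \<and> (\<forall>i<n. (A ^\<^sub>m k) $$ (i, i) = A $$ (i, i) ^ k)"
proof (induction k)
  case 0
  then show ?case using assms by auto
next
  case (Suc k)
  then show ?case
    using upper_triangular_mult[OF pow_carrier_mat[OF assms(1), of k] assms(1) _ assms(2)]
    by (auto simp: mult.commute)
qed

text \<open>Over the complex numbers the characteristic polynomial splits into linear factors, which
  is what Schur triangularisation requires.\<close>

lemma complex_similar_upper_triangular:
  fixes A :: "complex mat"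
  assumes "A \<in> carrier_mat n n"
  obtains B where "B \<in> carrier_mat n n" "upper_triangular B" "similar_mat A B"
  using char_poly_factorized[OF assms] schur_decomposition_exists[OF assms] by metis

lemma sum_in_Nats:
  fixes f :: "'s \<Rightarrow> 'a :: semiring_1"
  assumes "\<And>s. s \<in> S \<Longrightarrow> f s \<in> \<nat>"
  shows "(\<Sum>s\<in>S. f s) \<in> \<nat>"
  using assms by (induction S rule: infinite_finite_induct) auto

text \<open>After triangularisation, idempotence passes to each diagonal entry, so every one of them
  is 0 or 1. This is the source of all integrality in the proof.\<close>

lemma mat_trace_idempotent_nat:
  fixes P :: "complex mat"
  assumes "P \<in> carrier_mat n n" "P * P = P"
  shows "mat_trace P \<in> \<nat>"
proof -
  obtain B where B: "B \<in> carrier_mat n n" "upper_triangular B" "similar_mat P B"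
    using complex_similar_upper_triangular[OF assms(1)] .
  then obtain R S where w: "similar_mat_wit B P R S"
    using similar_mat_sym unfolding similar_mat_def by blast
  have "B * B = R * (P ^\<^sub>m 2) * S"
    using similar_mat_wit_pow_id[OF w, of 2] B by (simp add: numeral_2_eq_2)
  also have "\<dots> = B"
    using assms similar_mat_witD2(3)[OF B(1) w] by (simp add: numeral_2_eq_2)
  finally have BB: "B * B = B" .
  have "B $$ (i, i) \<in> \<nat>" if "i < n" for i
  proof -
    have "B $$ (i, i) * B $$ (i, i) = B $$ (i, i)"
      using upper_triangular_mult(2)[OF B(1) B(1) B(2) B(2) that] BB by simp
    then show ?thesis by auto
  qed
  then have "mat_trace B \<in> \<nat>"
    unfolding mat_trace_def using B(1) by (intro sum_in_Nats) auto
  then show ?thesis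
    using mat_trace_similar[OF B(3)] by simp
qed

section \<open>Entrywise sums of families of matrices\<close>

text \<open>A matrix value carries its own dimensions, so there is no single zero matrix to start a
  sum from. Fixing \<open>n\<close> and \<open>m\<close> gives sums over arbitrary index sets, the
  empty one included.\<close>

definition mat_sum :: "nat \<Rightarrow> nat \<Rightarrow> ('s \<Rightarrow> 'a :: comm_monoid_add mat) \<Rightarrow> 's set \<Rightarrow> 'a mat" where
  "mat_sum n m f S = mat n m (\<lambda>ij. \<Sum>s\<in>S. f s $$ ij)"

lemma mat_sum_carrier [simp]: "mat_sum n m f S \<in> carrier_mat n m"
  by (simp add: mat_sum_def)

lemma mat_sum_index: "i < n \<Longrightarrow> j < m \<Longrightarrow> mat_sum n m f S $$ (i, j) = (\<Sum>s\<in>S. f s $$ (i, j))"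
  by (simp add: mat_sum_def)

lemma mat_sum_cong:
  "(\<And>s. s \<in> S \<Longrightarrow> f s = g s) \<Longrightarrow> mat_sum n m f S = mat_sum n m g S"
  by (simp add: mat_sum_def)

lemma mat_sum_reindex_bij:
  "bij_betw h S T \<Longrightarrow> mat_sum n m (\<lambda>s. f (h s)) S = mat_sum n m f T"
  unfolding mat_sum_def by (intro eq_matI) (auto intro: sum.reindex_bij_betw)

lemma mult_mat_sum:
  fixes A :: "'a :: semiring_0 mat"
  assumes "A \<in> carrier_mat l n" "\<And>s. s \<in> S \<Longrightarrow> f s \<in> carrier_mat n m"
  shows "A * mat_sum n m f S = mat_sum l m (\<lambda>s. A * f s) S"
proof (rule eq_matI)
  fix i j assume "i < dim_row (mat_sum l m (\<lambda>s. A * f s) S)" "j < dim_col (mat_sum l m (\<lambda>s. A * f s) S)"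
  then have ij: "i < l" "j < m" by (auto simp: mat_sum_def)
  have "(A * mat_sum n m f S) $$ (i, j) = (\<Sum>k<n. A $$ (i, k) * (\<Sum>s\<in>S. f s $$ (k, j)))"
    using mult_mat_index_sum[OF assms(1) mat_sum_carrier ij] ij by (simp add: mat_sum_index)
  also have "\<dots> = (\<Sum>s\<in>S. \<Sum>k<n. A $$ (i, k) * f s $$ (k, j))"
    by (subst sum.swap) (simp add: sum_distrib_left)
  also have "\<dots> = (\<Sum>s\<in>S. (A * f s) $$ (i, j))"
    using mult_mat_index_sum[OF assms(1) assms(2) ij] by simp
  finally show "(A * mat_sum n m f S) $$ (i, j) = mat_sum l m (\<lambda>s. A * f s) S $$ (i, j)"
    using ij by (simp add: mat_sum_index)
qed (use assms in \<open>auto simp: mat_sum_def\<close>)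

lemma mat_sum_mult:
  fixes A :: "'a :: semiring_0 mat"
  assumes "A \<in> carrier_mat m l" "\<And>s. s \<in> S \<Longrightarrow> f s \<in> carrier_mat n m"
  shows "mat_sum n m f S * A = mat_sum n l (\<lambda>s. f s * A) S"
proof (rule eq_matI)
  fix i j assume "i < dim_row (mat_sum n l (\<lambda>s. f s * A) S)" "j < dim_col (mat_sum n l (\<lambda>s. f s * A) S)"
  then have ij: "i < n" "j < l" by (auto simp: mat_sum_def)
  have "(mat_sum n m f S * A) $$ (i, j) = (\<Sum>k<m. (\<Sum>s\<in>S. f s $$ (i, k)) * A $$ (k, j))"
    using mult_mat_index_sum[OF mat_sum_carrier assms(1) ij] ij by (simp add: mat_sum_index)
  also have "\<dots> = (\<Sum>s\<in>S. \<Sum>k<m. f s $$ (i, k) * A $$ (k, j))"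
    by (subst sum.swap) (simp add: sum_distrib_right)
  also have "\<dots> = (\<Sum>s\<in>S. (f s * A) $$ (i, j))"
    using mult_mat_index_sum[OF assms(2) assms(1) ij] by simp
  finally show "(mat_sum n m f S * A) $$ (i, j) = mat_sum n l (\<lambda>s. f s * A) S $$ (i, j)"
    using ij by (simp add: mat_sum_index)
qed (use assms in \<open>auto simp: mat_sum_def\<close>)

lemma mat_trace_mat_sum:
  assumes "\<And>s. s \<in> S \<Longrightarrow> f s \<in> carrier_mat n n"
  shows "mat_trace (mat_sum n n f S) = (\<Sum>s\<in>S. mat_trace (f s))"
proof -
  have "mat_trace (mat_sum n n f S) = (\<Sum>i<n. \<Sum>s\<in>S. f s $$ (i, i))"
    by (simp add: mat_trace_def mat_sum_def)
  also have "\<dots> = (\<Sum>s\<in>S. mat_trace (f s))"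
    using assms by (subst sum.swap) (auto simp: mat_trace_def intro!: sum.cong)
  finally show ?thesis .
qed

lemma transpose_mat_sum:
  assumes "\<And>s. s \<in> S \<Longrightarrow> f s \<in> carrier_mat n m"
  shows "transpose_mat (mat_sum n m f S) = mat_sum m n (\<lambda>s. transpose_mat (f s)) S"
proof (rule eq_matI)
  fix i j assume "i < dim_row (mat_sum m n (\<lambda>s. transpose_mat (f s)) S)"
    "j < dim_col (mat_sum m n (\<lambda>s. transpose_mat (f s)) S)"
  then have "i < m" "j < n" by (auto simp: mat_sum_def)
  then show "transpose_mat (mat_sum n m f S) $$ (i, j) = mat_sum m n (\<lambda>s. transpose_mat (f s)) S $$ (i, j)"
    by (auto simp: mat_sum_def carrier_matD[OF assms] intro!: sum.cong)
qed (auto simp: mat_sum_def)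

section \<open>Complex matrices of finite order\<close>

text \<open>This is the equality case of the triangle inequality: the real parts are at most 1 and
  add up to the number of terms, so each is 1, and the bound on the modulus then kills the imaginary
  part.\<close>

lemma sum_eq_card_imp_all_1:
  fixes f :: "'s \<Rightarrow> complex"
  assumes "finite S" "\<And>s. s \<in> S \<Longrightarrow> norm (f s) \<le> 1" "(\<Sum>s\<in>S. f s) = of_nat (card S)" "s \<in> S"
  shows "f s = 1"
proof -
  have le: "Re (f t) \<le> 1" if "t \<in> S" for t
    using assms(2)[OF that] complex_Re_le_cmod[of "f t"] by simp
  have "(\<Sum>t\<in>S. 1 - Re (f t)) = 0"
    using arg_cong[OF assms(3), of Re] by (simp add: sum_subtractf)
  then have "Re (f s) = 1"
    using assms(1,4) le by (subst (asm) sum_nonneg_eq_0_iff) auto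
  moreover have "(Re (f s))\<^sup>2 + (Im (f s))\<^sup>2 \<le> 1"
    using assms(2)[OF assms(4)] by (simp add: cmod_def)
  ultimately show ?thesis
    by (simp add: complex_eq_iff)
qed

text \<open>The sum \<open>P\<close> of the powers \<open>B ^\<^sub>m l\<close> for
  \<open>l < k\<close> is triangular with \<open>k\<close> on the diagonal, hence invertible. As
  \<open>B ^\<^sub>m k\<close> is the identity, multiplication by \<open>B\<close> only permutes the
  summands, so \<open>P * B = P\<close>, and \<open>P\<close> can be cancelled.\<close>

lemma unipotent_finite_order:
  fixes B :: "complex mat"
  assumes B: "B \<in> carrier_mat n n" "upper_triangular B" and diag: "\<And>i. i < n \<Longrightarrow> B $$ (i, i) = 1"
    and pow: "B ^\<^sub>m k = 1\<^sub>m n" "k > 0"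
  shows "B = 1\<^sub>m n"
proof -
  define P where "P = mat_sum n n (\<lambda>l. B ^\<^sub>m l) {..<k}"
  have P: "P \<in> carrier_mat n n" by (simp add: P_def)
  have utp: "upper_triangular (B ^\<^sub>m l)" "i < n \<Longrightarrow> (B ^\<^sub>m l) $$ (i, i) = 1" for l i
    using upper_triangular_pow[OF B] diag by auto
  have P0: "P $$ (i, j) = 0" if "j < i" "i < n" for i j
    using that B upper_triangularD[OF utp(1)] by (auto simp: P_def mat_sum_index intro!: sum.neutral)
  have Pd: "P $$ (i, i) = of_nat k" if "i < n" for i
    using that utp(2) by (simp add: P_def mat_sum_index)
  have "upper_triangular P"
    using P0 P by (intro upper_triangularI) auto
  then have "det P = (\<Prod>i<n. P $$ (i, i))"
    using P by (simp add: det_upper_triangular prod_list_diag_prod atLeast0LessThan)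
  then have "det P \<noteq> 0"
    using Pd \<open>k > 0\<close> by simp
  then obtain Q where Q: "Q \<in> carrier_mat n n" "Q * P = 1\<^sub>m n"
    using det_non_zero_imp_unit[OF P, of "()"] unfolding Units_def by (auto simp: ring_mat_simps)
  have "P * B = mat_sum n n (\<lambda>l. B ^\<^sub>m Suc l) {..<k}"
    unfolding P_def using B by (subst mat_sum_mult[of _ n]) auto
  also have "\<dots> = P"
  proof (rule eq_matI)
    fix i j assume "i < dim_row P" "j < dim_col P"
    then have ij: "i < n" "j < n" using P by auto
    \<comment> \<open>The sum over \<open>l < Suc k\<close> is split once at its last and once at
      its first term; these two terms agree because both are the identity.\<close>
    have "(\<Sum>l<k. (B ^\<^sub>m Suc l) $$ (i, j)) = (\<Sum>l<k. (B ^\<^sub>m l) $$ (i, j))"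
      using sum.lessThan_Suc[of "\<lambda>l. (B ^\<^sub>m l) $$ (i, j)" k]
        sum.lessThan_Suc_shift[of "\<lambda>l. (B ^\<^sub>m l) $$ (i, j)" k] pow(1) B
      by (simp del: pow_mat.simps(2))
    then show "mat_sum n n (\<lambda>l. B ^\<^sub>m Suc l) {..<k} $$ (i, j) = P $$ (i, j)"
      unfolding P_def by (simp only: mat_sum_index[OF ij])
  qed (use P in \<open>auto simp: mat_sum_def\<close>)
  finally have "P * B = P" .
  then have "(Q * P) * B = Q * P"
    using assoc_mult_mat[OF Q(1) P B(1)] by simp
  then show ?thesis
    using Q B by simp
qed

text \<open>The diagonal of a triangular form consists of \<open>k\<close>-th roots of unity, which
  gives the bound. In the equality case all of them are 1, so the triangular form is unipotent of
  finite order and therefore trivial.\<close>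

lemma finite_order_trace:
  fixes A :: "complex mat"
  assumes A: "A \<in> carrier_mat n n" and pow: "A ^\<^sub>m k = 1\<^sub>m n" "k > 0"
  shows "norm (mat_trace A) \<le> n"
    and "mat_trace A = of_nat n \<Longrightarrow> A = 1\<^sub>m n"
proof -
  obtain B where B: "B \<in> carrier_mat n n" "upper_triangular B" "similar_mat A B"
    using complex_similar_upper_triangular[OF A] .
  then obtain P Q where w: "similar_mat_wit A B P Q"
    unfolding similar_mat_def by blast
  note wD = similar_mat_witD2[OF A w]
  have wB: "similar_mat_wit B A Q P" by (rule similar_mat_wit_sym[OF w])
  have "B ^\<^sub>m k = Q * 1\<^sub>m n * P"
    using similar_mat_wit_pow_id[OF wB, of k] pow by simp
  then have Bk: "B ^\<^sub>m k = 1\<^sub>m n"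
    using wD by simp
  have tr: "mat_trace A = (\<Sum>i<n. B $$ (i, i))"
    using mat_trace_similar[OF B(3)] B(1) by (simp add: mat_trace_def)
  have norm1: "norm (B $$ (i, i)) = 1" if "i < n" for i
  proof -
    have "B $$ (i, i) ^ k = 1"
      using upper_triangular_pow[OF B(1,2), of k] Bk that by auto
    then show ?thesis
      using \<open>k > 0\<close> power_eq_1_iff by blast
  qed
  show "norm (mat_trace A) \<le> n"
    unfolding tr by (rule order_trans[OF norm_sum]) (simp add: norm1)
  assume "mat_trace A = of_nat n"
  then have "B $$ (i, i) = 1" if "i < n" for i
    using that norm1 tr by (intro sum_eq_card_imp_all_1[of "{..<n}" "\<lambda>i. B $$ (i, i)"]) auto
  then have "B = 1\<^sub>m n"
    using unipotent_finite_order[OF B(1,2) _ Bk \<open>k > 0\<close>] by blast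
  then show "A = 1\<^sub>m n"
    using wD by simp
qed

subsection \<open>Kronecker products\<close>

text \<open>The range is cut into \<open>a\<close> blocks of length \<open>b\<close>; on each block
  the quotient is constant and the remainder runs through all values below \<open>b\<close>. This
  separates the two index parts of a Kronecker product.\<close>

lemma sum_div_mod_mult:
  fixes f g :: "nat \<Rightarrow> 'a :: comm_semiring_0"
  shows "(\<Sum>k<a * b. f (k div b) * g (k mod b)) = (\<Sum>i<a. f i) * (\<Sum>j<b. g j)"
proof -
  have "(\<Sum>k<a * b. f (k div b) * g (k mod b)) =
      (\<Sum>i<a. \<Sum>k\<in>{i * b..<i * b + b}. f (k div b) * g (k mod b))"
    by (rule sum.nat_group[symmetric])
  also have "\<dots> = (\<Sum>i<a. f i * (\<Sum>j<b. g j))"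
  proof (rule sum.cong[OF refl])
    fix i
    have "(\<Sum>k\<in>{i * b..<i * b + b}. f (k div b) * g (k mod b)) =
        (\<Sum>j<b. f ((j + i * b) div b) * g ((j + i * b) mod b))"
      using sum.shift_bounds_nat_ivl[of "\<lambda>k. f (k div b) * g (k mod b)" 0 "i * b" b]
      by (simp add: atLeast0LessThan add.commute)
    also have "\<dots> = (\<Sum>j<b. f i * g j)"
      by (intro sum.cong) auto
    finally show "(\<Sum>k\<in>{i * b..<i * b + b}. f (k div b) * g (k mod b)) = f i * (\<Sum>j<b. g j)"
      by (simp add: sum_distrib_left)
  qed
  finally show ?thesis
    by (simp add: sum_distrib_right)
qed

definition kronecker :: "'a :: times mat \<Rightarrow> 'a mat \<Rightarrow> 'a mat" where
  "kronecker A B = mat (dim_row A * dim_row B) (dim_col A * dim_col B)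
    (\<lambda>(i, j). A $$ (i div dim_row B, j div dim_col B) * B $$ (i mod dim_row B, j mod dim_col B))"

lemma kronecker_carrier [simp]:
  "A \<in> carrier_mat n m \<Longrightarrow> B \<in> carrier_mat n' m' \<Longrightarrow> kronecker A B \<in> carrier_mat (n * n') (m * m')"
  by (auto simp: kronecker_def)

lemma div_mod_bounds:
  fixes i n n' :: nat
  assumes "i < n * n'"
  shows "i div n' < n" "i mod n' < n'"
proof -
  show "i div n' < n" using assms by (simp add: less_mult_imp_div_less)
  show "i mod n' < n'" using assms by (cases "n' = 0") auto
qed

text \<open>The mixed-product rule makes the tensor product of two representations multiplicative.
  The summation index codes a pair, and the sum factors by \<open>sum_div_mod_mult\<close>.\<close>

lemma kronecker_mult:
  fixes A B C D :: "'a :: comm_semiring_0 mat"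
  assumes "A \<in> carrier_mat n m" "C \<in> carrier_mat m p" "B \<in> carrier_mat n' m'" "D \<in> carrier_mat m' p'"
  shows "kronecker A B * kronecker C D = kronecker (A * C) (B * D)"
proof (rule eq_matI)
  fix i j assume "i < dim_row (kronecker (A * C) (B * D))" "j < dim_col (kronecker (A * C) (B * D))"
  then have ij: "i < n * n'" "j < p * p'"
    using assms by (auto simp: kronecker_def)
  note b = div_mod_bounds[OF ij(1)] div_mod_bounds[OF ij(2)]
  have "(kronecker A B * kronecker C D) $$ (i, j) =
      (\<Sum>k<m * m'. kronecker A B $$ (i, k) * kronecker C D $$ (k, j))"
    using assms ij by (intro mult_mat_index_sum) auto
  also have "\<dots> = (\<Sum>k<m * m'. (A $$ (i div n', k div m') * C $$ (k div m', j div p')) *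
      (B $$ (i mod n', k mod m') * D $$ (k mod m', j mod p')))"
    using assms ij by (intro sum.cong) (auto simp: kronecker_def ac_simps)
  also have "\<dots> = (A * C) $$ (i div n', j div p') * (B * D) $$ (i mod n', j mod p')"
    unfolding mult_mat_index_sum[OF assms(1,2) b(1,3)] mult_mat_index_sum[OF assms(3,4) b(2,4)]
    by (rule sum_div_mod_mult)
  also have "\<dots> = kronecker (A * C) (B * D) $$ (i, j)"
    using assms ij by (simp add: kronecker_def)
  finally show "(kronecker A B * kronecker C D) $$ (i, j) = kronecker (A * C) (B * D) $$ (i, j)" .
qed (use assms in \<open>auto simp: kronecker_def\<close>)

lemma kronecker_one: "kronecker (1\<^sub>m n) (1\<^sub>m m) = (1\<^sub>m (n * m) :: 'a :: semiring_1 mat)"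
proof (rule eq_matI)
  fix i j assume "i < dim_row (1\<^sub>m (n * m) :: 'a mat)" "j < dim_col (1\<^sub>m (n * m) :: 'a mat)"
  then have ij: "i < n * m" "j < n * m" by auto
  note b = div_mod_bounds[OF ij(1)] div_mod_bounds[OF ij(2)]
  have "i = j \<longleftrightarrow> i div m = j div m \<and> i mod m = j mod m"
    by (metis div_mult_mod_eq)
  then show "kronecker (1\<^sub>m n) (1\<^sub>m m) $$ (i, j) = (1\<^sub>m (n * m) :: 'a mat) $$ (i, j)"
    using ij b by (auto simp: kronecker_def)
qed (auto simp: kronecker_def)

lemma mat_trace_kronecker:
  fixes A B :: "'a :: comm_semiring_0 mat"
  assumes "A \<in> carrier_mat n n" "B \<in> carrier_mat m m"
  shows "mat_trace (kronecker A B) = mat_trace A * mat_trace B"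
proof -
  have "mat_trace (kronecker A B) = (\<Sum>i<n * m. A $$ (i div m, i div m) * B $$ (i mod m, i mod m))"
    using assms by (simp add: mat_trace_def kronecker_def)
  also have "\<dots> = mat_trace A * mat_trace B"
    using assms sum_div_mod_mult[of "\<lambda>i. A $$ (i, i)" m "\<lambda>i. B $$ (i, i)" n]
    by (simp add: mat_trace_def)
  finally show ?thesis .
qed

lemma mat_trace_transpose: "A \<in> carrier_mat n n \<Longrightarrow> mat_trace (transpose_mat A) = mat_trace A"
  by (simp add: mat_trace_def)

lemma mat_trace_one: "mat_trace (1\<^sub>m n :: 'a :: semiring_1 mat) = of_nat n"
  by (simp add: mat_trace_def)

lemma mat_trace_smult:
  "A \<in> carrier_mat n n \<Longrightarrow> mat_trace (c \<cdot>\<^sub>m A) = (c :: 'a :: semiring_0) * mat_trace A"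
  by (simp add: mat_trace_def sum_distrib_left)

subsection \<open>Representations of finite groups\<close>

text \<open>Invertibility comes for free: the image of the inverse element inverts the matrix once
  \<open>\<one>\<close> is sent to the identity. Later constructions therefore only have to check
  dimensions, products and the value at \<open>\<one>\<close>.\<close>

lemma representation_iff:
  assumes "group G"
  shows "representation G n \<rho> \<longleftrightarrow> n > 0 \<and> (\<forall>x\<in>carrier G. \<rho> x \<in> carrier_mat n n) \<and>
    (\<forall>x\<in>carrier G. \<forall>y\<in>carrier G. \<rho> (x \<otimes>\<^bsub>G\<^esub> y) = \<rho> x * \<rho> y) \<and> \<rho> \<one>\<^bsub>G\<^esub> = 1\<^sub>m n"
    (is "_ \<longleftrightarrow> ?R")
proof
  assume rep: "representation G n \<rho>"
  then show ?R
    using representation_one[OF assms rep]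
    by (auto simp: representation_def hom_def general_linear_def units_of_def Units_def ring_mat_simps)
next
  interpret G: group G by fact
  assume R: ?R
  have "\<rho> x \<in> Units (ring_mat TYPE(complex) n ())" if x: "x \<in> carrier G" for x
  proof -
    have "\<rho> x * \<rho> (inv\<^bsub>G\<^esub> x) = 1\<^sub>m n" "\<rho> (inv\<^bsub>G\<^esub> x) * \<rho> x = 1\<^sub>m n"
      using R x G.inv_closed[OF x] G.r_inv[OF x] G.l_inv[OF x] by metis+
    then show ?thesis
      using R x G.inv_closed[OF x] by (auto simp: Units_def ring_mat_simps)
  qed
  then show "representation G n \<rho>"
    using R by (auto simp: representation_def hom_def general_linear_def units_of_def ring_mat_simps)
qed

context group
begin

lemma representationD:
  assumes "representation G n \<rho>"
  shows "n > 0" "x \<in> carrier G \<Longrightarrow> \<rho> x \<in> carrier_mat n n"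
    "x \<in> carrier G \<Longrightarrow> y \<in> carrier G \<Longrightarrow> \<rho> (x \<otimes> y) = \<rho> x * \<rho> y"
    "\<rho> \<one> = 1\<^sub>m n"
  using assms representation_iff[OF group_axioms] by auto

lemma representation_subgroup:
  assumes "representation G n \<rho>" "subgroup H G"
  shows "representation (G\<lparr>carrier := H\<rparr>) n \<rho>"
  using representationD[OF assms(1)] subgroup.mem_carrier[OF assms(2)]
  by (simp add: representation_iff[OF subgroup_imp_group[OF assms(2)]])

lemma representation_kronecker:
  assumes "representation G n \<rho>" "representation G m \<sigma>"
  shows "representation G (n * m) (\<lambda>x. kronecker (\<rho> x) (\<sigma> x))"
  using representationD[OF assms(1)] representationD[OF assms(2)]
  by (auto simp: representation_iff[OF group_axioms] kronecker_one
      kronecker_mult[of _ n n _ n _ m m _ m])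

text \<open>Transposition and inversion both reverse products, so together they preserve
  them.\<close>

lemma representation_dual:
  assumes "representation G n \<rho>"
  shows "representation G n (\<lambda>x. transpose_mat (\<rho> (inv x)))"
  using representationD[OF assms]
  by (auto simp: representation_iff[OF group_axioms] inv_mult_group transpose_mult[of _ n n _ n])

lemma representation_pow:
  assumes "representation G n \<rho>" "x \<in> carrier G"
  shows "\<rho> (x [^] (k :: nat)) = \<rho> x ^\<^sub>m k"
  using representationD[OF assms(1)] assms(2) by (induction k) auto

text \<open>Every element has order dividing the group order, so its matrix has finite order and
  \<open>finite_order_trace\<close> applies.\<close>

lemma representation_trace:
  assumes "finite (carrier G)" "representation G n \<rho>" "x \<in> carrier G"
  shows "norm (mat_trace (\<rho> x)) \<le> n"
    and "mat_trace (\<rho> x) = of_nat n \<Longrightarrow> \<rho> x = 1\<^sub>m n"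
proof -
  have "\<rho> x ^\<^sub>m Coset.order G = 1\<^sub>m n"
    using representation_pow[OF assms(2,3), of "Coset.order G"] pow_order_eq_1[OF assms(3)]
      representationD(4)[OF assms(2)] by simp
  moreover have "Coset.order G > 0"
    using order_gt_0_iff_finite assms(1) by blast
  ultimately show "norm (mat_trace (\<rho> x)) \<le> n" "mat_trace (\<rho> x) = of_nat n \<Longrightarrow> \<rho> x = 1\<^sub>m n"
    using finite_order_trace[OF representationD(2)[OF assms(2,3)]] by blast+
qed

text \<open>A character attains its degree only at elements represented by the identity, so the
  kernel read off from character values is the kernel of the homomorphism.\<close>

lemma char_kernel_afforded_character:
  assumes "finite (carrier G)" "representation G n \<rho>"
  shows "char_kernel G (afforded_character G \<rho>) = {x \<in> carrier G. \<rho> x = 1\<^sub>m n}"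
  by (auto simp: char_kernel_def afforded_character_def representationD(4)[OF assms(2)] mat_trace_one
      intro: representation_trace(2)[OF assms])

lemma subgroup_char_kernel:
  assumes "finite (carrier G)" "\<phi> \<in> characters G"
  shows "subgroup (char_kernel G \<phi>) G"
proof -
  obtain n \<rho> where rep: "representation G n \<rho>" and \<phi>: "\<phi> = afforded_character G \<rho>"
    using assms(2) unfolding characters_def by blast
  note D = representationD[OF rep]
  have ker: "char_kernel G \<phi> = {x \<in> carrier G. \<rho> x = 1\<^sub>m n}"
    using char_kernel_afforded_character[OF assms(1) rep] \<phi> by simp
  show ?thesis
  proof (rule subgroupI)
    show "char_kernel G \<phi> \<noteq> {}" using D(4) ker by auto
    fix a assume a: "a \<in> char_kernel G \<phi>"
    then have "\<rho> (inv a) = \<rho> (inv a) * \<rho> a"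
      using ker D(2)[of "inv a"] by simp
    also have "\<dots> = 1\<^sub>m n"
      using a ker D(3)[of "inv a" a] D(4) by (simp add: l_inv)
    finally show "inv a \<in> char_kernel G \<phi>"
      using a ker by simp
  qed (use ker D in auto)
qed

text \<open>Left translation by \<open>h\<close> permutes the group, with translation by
  \<open>inv h\<close> as its inverse. All averaging arguments below rest on this.\<close>

lemma sum_translate:
  assumes "h \<in> carrier G"
  shows "mat_sum n m (\<lambda>x. f (h \<otimes> x)) (carrier G) = mat_sum n m f (carrier G)"
proof (rule mat_sum_reindex_bij)
  show "bij_betw (\<lambda>x. h \<otimes> x) (carrier G) (carrier G)"
    using assms by (intro bij_betw_byWitness[where f' = "\<lambda>x. inv h \<otimes> x"])
      (auto simp: m_assoc[symmetric])
qed

text \<open>The average is the trace of the projection onto the fixed vectors.\<close>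

lemma trace_average_nat:
  assumes "finite (carrier G)" "representation G n \<rho>"
  shows "(\<Sum>x\<in>carrier G. mat_trace (\<rho> x)) / of_nat (card (carrier G)) \<in> \<nat>"
proof -
  define c :: complex where "c = 1 / of_nat (card (carrier G))"
  have c: "of_nat (card (carrier G)) * c = 1"
    using assms(1) by (auto simp: c_def card_eq_0_iff)
  define P where "P = mat_sum n n (\<lambda>x. c \<cdot>\<^sub>m \<rho> x) (carrier G)"
  note D = representationD[OF assms(2)]
  have P: "P \<in> carrier_mat n n" by (simp add: P_def)
  \<comment> \<open>Multiplication by \<rho>(h) is absorbed into the summation index. Hence
    \<open>P * P\<close> is an average of copies of \<open>P\<close>, which makes \<open>P\<close>
    idempotent.\<close>
  have fix_P: "\<rho> h * P = P" if h: "h \<in> carrier G" for h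
  proof -
    have "\<rho> h * P = mat_sum n n (\<lambda>x. c \<cdot>\<^sub>m \<rho> (h \<otimes> x)) (carrier G)"
      unfolding P_def using D h
      by (subst mult_mat_sum[of _ n n]) (auto intro!: mat_sum_cong simp: mult_smult_distrib[of _ n n _ n])
    then show ?thesis
      using sum_translate[OF h] by (simp add: P_def)
  qed
  have "P * P = mat_sum n n (\<lambda>x. (c \<cdot>\<^sub>m \<rho> x) * P) (carrier G)"
    unfolding P_def using D P by (subst mat_sum_mult[of _ n n]) (auto simp: P_def)
  also have "\<dots> = mat_sum n n (\<lambda>x. c \<cdot>\<^sub>m P) (carrier G)"
    using D P fix_P by (intro mat_sum_cong) (simp add: mult_smult_assoc_mat[of _ n n _ n])
  also have "\<dots> = P"
  proof (rule eq_matI)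
    fix i j assume "i < dim_row P" "j < dim_col P"
    then show "mat_sum n n (\<lambda>x. c \<cdot>\<^sub>m P) (carrier G) $$ (i, j) = P $$ (i, j)"
      using P c by (simp add: mat_sum_index mult.assoc[symmetric])
  qed (use P in \<open>auto simp: mat_sum_def\<close>)
  finally have "mat_trace P \<in> \<nat>"
    by (rule mat_trace_idempotent_nat[OF P])
  moreover have "mat_trace P = (\<Sum>x\<in>carrier G. mat_trace (\<rho> x)) / of_nat (card (carrier G))"
    unfolding P_def using D
    by (subst mat_trace_mat_sum) (auto simp: mat_trace_smult[of _ n] c_def sum_divide_distrib)
  ultimately show ?thesis by simp
qed

section \<open>Schur's lemma and sums of conjugates\<close>

text \<open>A complex matrix of positive size has an eigenvalue. Its eigenspace is invariant because
  \<open>Z\<close> commutes with the representation, and it is nonzero, so irreducibility makes it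
  the whole space; unit vectors then reveal the entries of \<open>Z\<close>.\<close>

lemma schur_scalar:
  assumes irr: "irreducible_representation G n \<rho>" and Z: "Z \<in> carrier_mat n n"
    and comm: "\<And>x. x \<in> carrier G \<Longrightarrow> \<rho> x * Z = Z * \<rho> x"
  shows "\<exists>z. Z = z \<cdot>\<^sub>m 1\<^sub>m n"
proof -
  have rep: "representation G n \<rho>"
    using irr by (simp add: irreducible_representation_def)
  note D = representationD[OF rep]
  obtain z where "eigenvalue Z z"
    using spectrum_non_empty[OF Z D(1)] by (auto simp: spectrum_def)
  then obtain v where v: "v \<in> carrier_vec n" "v \<noteq> 0\<^sub>v n" "Z *\<^sub>v v = z \<cdot>\<^sub>v v"
    using Z by (auto simp: eigenvalue_def eigenvector_def)
  define W where "W = {w \<in> carrier_vec n. Z *\<^sub>v w = z \<cdot>\<^sub>v w}"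
  have "VectorSpace.subspace class_ring W (module_vec TYPE(complex) n)"
  proof -
    interpret vec_space "TYPE(complex)" n .
    show ?thesis
      unfolding subspace_def submodule_def
      using Z vectorspace_axioms module_axioms
      by (auto simp: W_def module_vec_simps mult_add_distrib_mat_vec[of _ n n]
          mult_mat_vec[of _ n n] smult_add_distrib_vec[of _ n] smult_smult_assoc mult.commute)
  qed
  moreover have "\<rho> x *\<^sub>v w \<in> W" if x: "x \<in> carrier G" and w: "w \<in> W" for x w
  proof -
    have w': "w \<in> carrier_vec n" "Z *\<^sub>v w = z \<cdot>\<^sub>v w" using w by (auto simp: W_def)
    have "Z *\<^sub>v (\<rho> x *\<^sub>v w) = (\<rho> x * Z) *\<^sub>v w"
      using D(2)[OF x] Z w' comm[OF x] by simp
    also have "\<dots> = z \<cdot>\<^sub>v (\<rho> x *\<^sub>v w)"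
      using D(2)[OF x] Z w' by (simp add: mult_mat_vec[of _ n n])
    finally show ?thesis
      using D(2)[OF x] w' by (simp add: W_def)
  qed
  ultimately have "W = {0\<^sub>v n} \<or> W = carrier_vec n"
    using irr by (auto simp: irreducible_representation_def)
  moreover have "v \<in> W" using v by (simp add: W_def)
  ultimately have W: "W = carrier_vec n" using v by auto
  have "Z = z \<cdot>\<^sub>m 1\<^sub>m n"
  proof (rule eq_matI)
    fix i j assume "i < dim_row (z \<cdot>\<^sub>m 1\<^sub>m n)" "j < dim_col (z \<cdot>\<^sub>m 1\<^sub>m n)"
    then have ij: "i < n" "j < n" by auto
    have "unit_vec n j \<in> W" using W by simp
    then have "(Z *\<^sub>v unit_vec n j) $ i = (z \<cdot>\<^sub>v unit_vec n j) $ i"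
      by (simp add: W_def)
    then show "Z $$ (i, j) = (z \<cdot>\<^sub>m 1\<^sub>m n) $$ (i, j)"
      using ij Z by simp
  qed (use Z in auto)
  then show ?thesis by blast
qed

text \<open>The sum over all conjugates is invariant under conjugation, so Schur's lemma makes it
  scalar. Comparing traces determines the scalar, since conjugate elements have equal trace.\<close>

lemma sum_conjugates_scalar:
  assumes irr: "irreducible_representation G n \<rho>" and y: "y \<in> carrier G"
  shows "mat_sum n n (\<lambda>x. \<rho> (x \<otimes> y \<otimes> inv x)) (carrier G) =
    (of_nat (card (carrier G)) * mat_trace (\<rho> y) / of_nat n) \<cdot>\<^sub>m 1\<^sub>m n" (is "?Z = _")
proof -
  have rep: "representation G n \<rho>"
    using irr by (simp add: irreducible_representation_def)
  note D = representationD[OF rep]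
  have Z: "?Z \<in> carrier_mat n n" by simp
  have conj: "\<rho> (x \<otimes> y \<otimes> inv x) \<in> carrier_mat n n" if "x \<in> carrier G" for x
    using that y by (intro D(2)) simp
  have "\<rho> h * ?Z = ?Z * \<rho> h" if h: "h \<in> carrier G" for h
  proof -
    have "\<rho> h * ?Z = mat_sum n n (\<lambda>x. \<rho> h * \<rho> (x \<otimes> y \<otimes> inv x)) (carrier G)"
      using D(2)[OF h] conj by (rule mult_mat_sum)
    \<comment> \<open>The factor \<open>h\<close> is moved to the right end by writing
      \<open>h \<otimes> (x \<otimes> y \<otimes> inv x)\<close> as the conjugate of
      \<open>y\<close> by \<open>h \<otimes> x\<close>, times \<open>h\<close>; the index can then
      be translated back.\<close>
    also have "\<dots> = mat_sum n n (\<lambda>x. \<rho> ((h \<otimes> x) \<otimes> y \<otimes> inv (h \<otimes> x)) * \<rho> h) (carrier G)"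
      using D(3)[symmetric] h y by (intro mat_sum_cong) (simp add: inv_mult_group m_assoc)
    also have "\<dots> = mat_sum n n (\<lambda>x. \<rho> (x \<otimes> y \<otimes> inv x) * \<rho> h) (carrier G)"
      by (rule sum_translate[OF h])
    also have "\<dots> = ?Z * \<rho> h"
      using D(2)[OF h] conj by (rule mat_sum_mult[symmetric])
    finally show ?thesis .
  qed
  then obtain z where z: "?Z = z \<cdot>\<^sub>m 1\<^sub>m n"
    using schur_scalar[OF irr Z] by blast
  have "mat_trace (\<rho> (x \<otimes> y \<otimes> inv x)) = mat_trace (\<rho> y)" if x: "x \<in> carrier G" for x
  proof -
    have "mat_trace (\<rho> (x \<otimes> y \<otimes> inv x)) = mat_trace (\<rho> (x \<otimes> y) * \<rho> (inv x))"
      using D(3) x y by simp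
    also have "\<dots> = mat_trace (\<rho> (inv x) * \<rho> (x \<otimes> y))"
      using x y by (intro mat_trace_mult_comm[of _ n n] D(2)) simp_all
    also have "\<dots> = mat_trace (\<rho> y)"
      using D(3)[symmetric] x y by (simp add: m_assoc[symmetric])
    finally show ?thesis .
  qed
  then have "mat_trace ?Z = of_nat (card (carrier G)) * mat_trace (\<rho> y)"
    using conj by (simp add: mat_trace_mat_sum)
  moreover have "mat_trace ?Z = z * of_nat n"
    unfolding z by (simp add: mat_trace_smult[of _ n] mat_trace_one)
  ultimately have "z = of_nat (card (carrier G)) * mat_trace (\<rho> y) / of_nat n"
    using D(1) by (simp add: field_simps)
  then show ?thesis using z by simp
qed


section \<open>Intertwiners and character values on a normal subgroup\<close>

text \<open>Expanding the traces yields diagonal positions \<open>i\<close> and \<open>j\<close> for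
  which the sum of products of entries is nonzero. Averaging the matrix unit at
  \<open>(i, j)\<close> over the group gives an intertwiner from the dual of \<sigma> to \<rho>, and
  that nonzero sum is precisely its \<open>(i, j)\<close> entry.\<close>

lemma exists_intertwiner:
  assumes "representation G n \<rho>" "representation G m \<sigma>"
    and nz: "(\<Sum>x\<in>carrier G. mat_trace (\<rho> x) * mat_trace (\<sigma> x)) \<noteq> 0"
  obtains T where "T \<in> carrier_mat n m" "T \<noteq> 0\<^sub>m n m"
    "\<And>h. h \<in> carrier G \<Longrightarrow> \<rho> h * T = T * transpose_mat (\<sigma> (inv h))"
proof -
  note R = representationD[OF assms(1)] and S = representationD[OF assms(2)]
  have "(\<Sum>x\<in>carrier G. mat_trace (\<rho> x) * mat_trace (\<sigma> x)) =
      (\<Sum>x\<in>carrier G. \<Sum>i<n. \<Sum>j<m. \<rho> x $$ (i, i) * \<sigma> x $$ (j, j))"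
  proof (rule sum.cong[OF refl])
    fix x assume "x \<in> carrier G"
    then have "dim_row (\<rho> x) = n" "dim_row (\<sigma> x) = m" using R(2) S(2) by auto
    then show "mat_trace (\<rho> x) * mat_trace (\<sigma> x) = (\<Sum>i<n. \<Sum>j<m. \<rho> x $$ (i, i) * \<sigma> x $$ (j, j))"
      by (simp add: mat_trace_def sum_product)
  qed
  also have "\<dots> = (\<Sum>i<n. \<Sum>j<m. \<Sum>x\<in>carrier G. \<rho> x $$ (i, i) * \<sigma> x $$ (j, j))"
    by (subst sum.swap, intro sum.cong refl, subst sum.swap) simp
  finally obtain i j where ij: "i < n" "j < m"
    and nz_ij: "(\<Sum>x\<in>carrier G. \<rho> x $$ (i, i) * \<sigma> x $$ (j, j)) \<noteq> 0"
    using nz by (metis (no_types, lifting) lessThan_iff sum.neutral)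
  define E :: "complex mat" where "E = mat n m (\<lambda>kl. if kl = (i, j) then 1 else 0)"
  have E: "E \<in> carrier_mat n m" by (simp add: E_def)
  define F where "F x = \<rho> x * E * transpose_mat (\<sigma> x)" for x
  have F: "F x \<in> carrier_mat n m" if "x \<in> carrier G" for x
    using R(2)[OF that] S(2)[OF that] E by (auto simp: F_def)
  have F_index: "F x $$ (i, j) = \<rho> x $$ (i, i) * \<sigma> x $$ (j, j)" if x: "x \<in> carrier G" for x
  proof -
    note Rx = R(2)[OF x] and Sx = S(2)[OF x]
    have RE: "(\<rho> x * E) $$ (i, l) = (if l = j then \<rho> x $$ (i, i) else 0)" if "l < m" for l
    proof -
      have "(\<rho> x * E) $$ (i, l) = (\<Sum>k<n. \<rho> x $$ (i, k) * E $$ (k, l))"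
        using mult_mat_index_sum[OF Rx E ij(1) that] .
      also have "\<dots> = (\<Sum>k<n. if k = i then (if l = j then \<rho> x $$ (i, i) else 0) else 0)"
        using that by (intro sum.cong) (auto simp: E_def)
      finally show ?thesis using ij by simp
    qed
    have "F x $$ (i, j) = (\<Sum>l<m. (\<rho> x * E) $$ (i, l) * transpose_mat (\<sigma> x) $$ (l, j))"
      unfolding F_def using Rx Sx E ij by (intro mult_mat_index_sum[of _ n m _ m]) auto
    also have "\<dots> = (\<Sum>l<m. if l = j then \<rho> x $$ (i, i) * \<sigma> x $$ (j, j) else 0)"
      using RE Sx ij by (intro sum.cong) auto
    finally show ?thesis using ij by simp
  qed
  define T where "T = mat_sum n m F (carrier G)"
  have T: "T \<in> carrier_mat n m" by (simp add: T_def)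
  have fix_T: "\<rho> h * T * transpose_mat (\<sigma> h) = T" if h: "h \<in> carrier G" for h
  proof -
    \<comment> \<open>Transposition reverses the product coming from \<sigma>, so the contribution
      of \<open>h\<close> ends up outermost on both sides.\<close>
    have FF: "\<rho> h * F x * transpose_mat (\<sigma> h) = F (h \<otimes> x)" if x: "x \<in> carrier G" for x
    proof -
      note c = R(2)[OF h] R(2)[OF x] S(2)[OF h] S(2)[OF x] E
      have "F (h \<otimes> x) = (\<rho> h * \<rho> x) * E * (transpose_mat (\<sigma> x) * transpose_mat (\<sigma> h))"
        unfolding F_def R(3)[OF h x] S(3)[OF h x] transpose_mult[OF c(3,4)] ..
      also have "\<dots> = \<rho> h * F x * transpose_mat (\<sigma> h)"
        unfolding F_def using c by (simp only: assoc_mult_mat[of _ n n _ n _ m] assoc_mult_mat[of _ n n _ m _ m]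
            assoc_mult_mat[of _ n m _ m _ m] mult_carrier_mat[of _ n n _ m] mult_carrier_mat[of _ n m _ m]
            mult_carrier_mat[of _ m m _ m] transpose_carrier_mat)
      finally show ?thesis by simp
    qed
    have "\<rho> h * T = mat_sum n m (\<lambda>x. \<rho> h * F x) (carrier G)"
      unfolding T_def using R(2)[OF h] F by (rule mult_mat_sum)
    moreover have "\<dots> * transpose_mat (\<sigma> h) =
        mat_sum n m (\<lambda>x. \<rho> h * F x * transpose_mat (\<sigma> h)) (carrier G)"
      using R(2)[OF h] S(2)[OF h] F by (intro mat_sum_mult[of _ m]) auto
    ultimately have "\<rho> h * T * transpose_mat (\<sigma> h) =
        mat_sum n m (\<lambda>x. \<rho> h * F x * transpose_mat (\<sigma> h)) (carrier G)"
      by simp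
    also have "\<dots> = mat_sum n m (\<lambda>x. F (h \<otimes> x)) (carrier G)"
      by (intro mat_sum_cong FF)
    also have "\<dots> = T"
      unfolding T_def by (rule sum_translate[OF h])
    finally show ?thesis .
  qed
  show thesis
  proof
    show "T \<in> carrier_mat n m" by fact
    have "T $$ (i, j) \<noteq> 0"
      using nz_ij F_index ij by (simp add: T_def mat_sum_index)
    then show "T \<noteq> 0\<^sub>m n m" using ij by auto
    fix h assume h: "h \<in> carrier G"
    then have ih: "inv h \<in> carrier G" by simp
    \<comment> \<open>The invariance \<open>fix_T\<close> becomes the intertwining relation once the
      right factor is cancelled by its inverse, the transpose of
      \<open>\<sigma> (inv h)\<close>.\<close>
    have "\<sigma> (inv h) * \<sigma> h = 1\<^sub>m m"
      using S(3)[OF ih h] S(4) h by simp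
    then have one: "transpose_mat (\<sigma> h) * transpose_mat (\<sigma> (inv h)) = 1\<^sub>m m"
      using transpose_mult[OF S(2)[OF ih] S(2)[OF h]] by simp
    have "T * transpose_mat (\<sigma> (inv h)) = \<rho> h * T * transpose_mat (\<sigma> h) * transpose_mat (\<sigma> (inv h))"
      using fix_T[OF h] by simp
    also have "\<dots> = \<rho> h * T * (transpose_mat (\<sigma> h) * transpose_mat (\<sigma> (inv h)))"
      using R(2)[OF h] S(2)[OF h] S(2)[OF ih] T by (intro assoc_mult_mat) auto
    also have "\<dots> = \<rho> h * T"
      using R(2)[OF h] T by (simp add: one right_mult_one_mat[of _ n m])
    finally show "\<rho> h * T = T * transpose_mat (\<sigma> (inv h))" by simp
  qed
qed


text \<open>Summing the intertwining relation over the conjugates of \<open>y\<close> turns both representations into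
  the scalars of Schur's lemma, and these must agree because the intertwiner is nonzero.\<close>

lemma trace_ratio_on_normal_subgroup:
  assumes fin: "finite (carrier G)" and H: "H \<lhd> G"
    and irr: "irreducible_representation G n \<rho>" "irreducible_representation G m \<sigma>"
    and nz: "(\<Sum>x\<in>H. mat_trace (\<rho> x) * mat_trace (\<sigma> x)) \<noteq> 0"
    and y: "y \<in> H"
  shows "of_nat m * mat_trace (\<rho> y) = of_nat n * mat_trace (\<sigma> (inv y))"
proof -
  have sub: "subgroup H G" using H by (rule normal_imp_subgroup)
  have rep: "representation G n \<rho>" "representation G m \<sigma>"
    using irr by (simp_all add: irreducible_representation_def)
  note R = representationD[OF rep(1)] and S = representationD[OF rep(2)]
  interpret K: group "G\<lparr>carrier := H\<rparr>" by (rule subgroup_imp_group[OF sub])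
  obtain T where T: "T \<in> carrier_mat n m" "T \<noteq> 0\<^sub>m n m"
    and tw: "\<And>h. h \<in> H \<Longrightarrow> \<rho> h * T = T * transpose_mat (\<sigma> (inv h))"
  proof (rule K.exists_intertwiner[OF representation_subgroup[OF rep(1) sub]
        representation_subgroup[OF rep(2) sub]])
    show "(\<Sum>x\<in>carrier (G\<lparr>carrier := H\<rparr>). mat_trace (\<rho> x) * mat_trace (\<sigma> x)) \<noteq> 0"
      using nz by simp
  qed (simp add: m_inv_consistent[OF sub])
  \<comment> \<open>By \<open>sum_conjugates_scalar\<close> these are the scalars given by the
    conjugates of \<open>y\<close> under \<rho> and of \<open>inv y\<close> under \<sigma>. The
    inverse appears because \<open>T\<close> relates \<rho> to the dual of \<sigma>.\<close>
  define z :: complex where "z = of_nat (card (carrier G)) * mat_trace (\<rho> y) / of_nat n"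
  define w :: complex where "w = of_nat (card (carrier G)) * mat_trace (\<sigma> (inv y)) / of_nat m"
  have yG: "y \<in> carrier G" "inv y \<in> carrier G"
    using subgroup.mem_carrier[OF sub y] by simp_all
  \<comment> \<open>Normality keeps all conjugates of \<open>y\<close> under the whole group inside
    \<open>H\<close>, where the intertwining relation is available.\<close>
  have conj_H: "x \<otimes> y \<otimes> inv x \<in> H" if "x \<in> carrier G" for x
    using H that y by (auto simp: normal_inv_iff)
  have conj: "\<rho> (x \<otimes> y \<otimes> inv x) \<in> carrier_mat n n" "\<sigma> (x \<otimes> inv y \<otimes> inv x) \<in> carrier_mat m m"
    if "x \<in> carrier G" for x
    using that yG by (simp_all add: R(2) S(2))
  have "z \<cdot>\<^sub>m T = (z \<cdot>\<^sub>m 1\<^sub>m n) * T"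
    using T by (simp add: mult_smult_assoc_mat[of _ n n _ m])
  also have "\<dots> = mat_sum n n (\<lambda>x. \<rho> (x \<otimes> y \<otimes> inv x)) (carrier G) * T"
    unfolding z_def sum_conjugates_scalar[OF irr(1) yG(1)] ..
  also have "\<dots> = mat_sum n m (\<lambda>x. \<rho> (x \<otimes> y \<otimes> inv x) * T) (carrier G)"
    using T(1) conj(1) by (rule mat_sum_mult)
  also have "\<dots> = mat_sum n m (\<lambda>x. T * transpose_mat (\<sigma> (x \<otimes> inv y \<otimes> inv x))) (carrier G)"
  proof (rule mat_sum_cong)
    fix x assume x: "x \<in> carrier G"
    then have "inv (x \<otimes> y \<otimes> inv x) = x \<otimes> inv y \<otimes> inv x"
      using yG by (simp add: inv_mult_group m_assoc)
    then show "\<rho> (x \<otimes> y \<otimes> inv x) * T = T * transpose_mat (\<sigma> (x \<otimes> inv y \<otimes> inv x))"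
      using tw[OF conj_H[OF x]] by simp
  qed
  also have "\<dots> = T * mat_sum m m (\<lambda>x. transpose_mat (\<sigma> (x \<otimes> inv y \<otimes> inv x))) (carrier G)"
    using T(1) conj(2) by (intro mult_mat_sum[symmetric]) auto
  also have "mat_sum m m (\<lambda>x. transpose_mat (\<sigma> (x \<otimes> inv y \<otimes> inv x))) (carrier G) =
      transpose_mat (mat_sum m m (\<lambda>x. \<sigma> (x \<otimes> inv y \<otimes> inv x)) (carrier G))"
    using conj(2) by (rule transpose_mat_sum[symmetric])
  also have "\<dots> = w \<cdot>\<^sub>m 1\<^sub>m m"
    unfolding w_def sum_conjugates_scalar[OF irr(2) yG(2)] by (intro eq_matI) auto
  also have "T * (w \<cdot>\<^sub>m 1\<^sub>m m) = w \<cdot>\<^sub>m T"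
    using T by (simp add: mult_smult_distrib[of _ n m _ m])
  finally have zw: "z \<cdot>\<^sub>m T = w \<cdot>\<^sub>m T" .
  obtain i j where ij: "i < n" "j < m" "T $$ (i, j) \<noteq> 0"
    using T by (metis eq_matI carrier_matD index_zero_mat)
  have "z * T $$ (i, j) = w * T $$ (i, j)"
    using arg_cong[OF zw, of "\<lambda>M. M $$ (i, j)"] T(1) ij by simp
  then have "z = w" using ij by simp
  moreover have "card (carrier G) \<noteq> 0"
    using fin by (auto simp: card_eq_0_iff)
  ultimately show ?thesis
    using R(1) S(1) by (simp add: z_def w_def field_simps)
qed

text \<open>The summand is the trace of the tensor product of \<rho> with its dual, so
  \<open>trace_average_nat\<close> applies.\<close>

lemma trace_norm_average_nat:
  assumes fin: "finite (carrier G)" and rep: "representation G n \<rho>"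
  shows "(\<Sum>x\<in>carrier G. mat_trace (\<rho> x) * mat_trace (\<rho> (inv x))) / of_nat (card (carrier G)) \<in> \<nat>"
proof -
  have "(\<Sum>x\<in>carrier G. mat_trace (\<rho> x) * mat_trace (\<rho> (inv x))) =
      (\<Sum>x\<in>carrier G. mat_trace (kronecker (\<rho> x) (transpose_mat (\<rho> (inv x)))))"
    using representationD(2)[OF rep]
    by (intro sum.cong) (auto simp: mat_trace_kronecker[of _ n _ n] mat_trace_transpose[of _ n])
  then show ?thesis
    using trace_average_nat[OF fin representation_kronecker[OF rep representation_dual[OF rep]]] by simp
qed

end

section \<open>Integrality from coprime degrees\<close>

text \<open>With \<open>p\<close> and \<open>q\<close> the two natural multiples,
  cross-multiplication gives \<open>p * b\<^sup>2 = q * a\<^sup>2\<close>. Coprimality makes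
  \<open>a\<^sup>2\<close> divide \<open>p\<close>, and the quotient is \<open>c\<close>.\<close>

lemma coprime_squares_multiple_nat:
  fixes c :: "'a :: field_char_0"
  assumes "coprime a b" "a > 0" "c * of_nat (a\<^sup>2) \<in> \<nat>" "c * of_nat (b\<^sup>2) \<in> \<nat>"
  shows "c \<in> \<nat>"
proof -
  obtain p q where p: "c * of_nat (a\<^sup>2) = of_nat p" and q: "c * of_nat (b\<^sup>2) = of_nat q"
    using assms(3,4) by (auto elim!: Nats_cases)
  have "(of_nat (p * b\<^sup>2) :: 'a) = of_nat (q * a\<^sup>2)"
    unfolding of_nat_mult p[symmetric] q[symmetric] by (simp add: ac_simps)
  then have "p * b\<^sup>2 = q * a\<^sup>2"
    unfolding of_nat_eq_iff .
  then have "a\<^sup>2 dvd p * b\<^sup>2" by simp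
  then have "a\<^sup>2 dvd p"
    using assms(1) coprime_dvd_mult_left_iff[of "a\<^sup>2" "b\<^sup>2" p] by simp
  then obtain k where "p = a\<^sup>2 * k" by blast
  then have "c * of_nat (a\<^sup>2) = of_nat k * of_nat (a\<^sup>2)"
    using p by simp
  then have "c = of_nat k"
    using assms(2) by simp
  then show ?thesis by simp
qed

context group
begin

text \<open>On \<open>H\<close> both trace functions are expressed through one normalised function
  \<omega>, whose squared norm is an integer by coprimality of the degrees. It lies between 0 and 1
  and is nonzero, so it is 1, which forces equality in every summand.\<close>

lemma trace_product_on_normal_subgroup:
  assumes fin: "finite (carrier G)" and H: "H \<lhd> G"
    and irr: "irreducible_representation G n \<rho>" "irreducible_representation G m \<sigma>"
    and cop: "coprime n m"
    and nz: "(\<Sum>x\<in>H. mat_trace (\<rho> x) * mat_trace (\<sigma> x)) \<noteq> 0"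
    and y: "y \<in> H"
  shows "mat_trace (\<rho> y) * mat_trace (\<sigma> y) = of_nat (n * m)"
proof -
  have sub: "subgroup H G" using H by (rule normal_imp_subgroup)
  have rep: "representation G n \<rho>" "representation G m \<sigma>"
    using irr by (simp_all add: irreducible_representation_def)
  have pos: "n > 0" "m > 0"
    using representationD(1)[OF rep(1)] representationD(1)[OF rep(2)] by auto
  have HG: "H \<subseteq> carrier G" using sub by (rule subgroup.subset)
  have finH: "finite H" using HG fin by (rule finite_subset)
  have cardH: "card H \<noteq> 0" using finH y by auto
  interpret K: group "G\<lparr>carrier := H\<rparr>" by (rule subgroup_imp_group[OF sub])
  have invH: "inv x \<in> H" if "x \<in> H" for x
    using that sub by (simp add: subgroup.m_inv_closed)
  define \<omega> :: "'a \<Rightarrow> complex" where "\<omega> x = mat_trace (\<rho> x) / of_nat n" for x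
  have \<rho>: "mat_trace (\<rho> x) = of_nat n * \<omega> x" for x
    using pos by (simp add: \<omega>_def)
  have \<sigma>_inv: "mat_trace (\<sigma> (inv x)) = of_nat m * \<omega> x" if "x \<in> H" for x
    using trace_ratio_on_normal_subgroup[OF fin H irr nz that] pos by (simp add: \<omega>_def field_simps)
  have \<sigma>: "mat_trace (\<sigma> x) = of_nat m * \<omega> (inv x)" if "x \<in> H" for x
    using \<sigma>_inv[OF invH[OF that]] that HG by (simp add: subsetD)
  have norm_\<omega>: "norm (\<omega> x) \<le> 1" if "x \<in> carrier G" for x
    using representation_trace(1)[OF fin rep(1) that] pos by (simp add: \<omega>_def norm_divide)
  have norm_prod: "norm (\<omega> x * \<omega> (inv x)) \<le> 1" if "x \<in> H" for x
    using that HG norm_\<omega>[of x] norm_\<omega>[of "inv x"] by (simp add: norm_mult mult_le_one subsetD)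
  define c where "c = (\<Sum>x\<in>H. \<omega> x * \<omega> (inv x)) / of_nat (card H)"
  have cH: "(\<Sum>x\<in>H. \<omega> x * \<omega> (inv x)) = c * of_nat (card H)"
    using cardH by (simp add: c_def)
  have "c * of_nat (n\<^sup>2) \<in> \<nat>"
    using K.trace_norm_average_nat[OF _ representation_subgroup[OF rep(1) sub]] finH
    by (simp add: m_inv_consistent[OF sub] \<rho> c_def power2_eq_square ac_simps
        sum_distrib_left[symmetric] cong: sum.cong)
  \<comment> \<open>For \<sigma> the arguments \<open>x\<close> and \<open>inv x\<close> are
    exchanged. This leaves \<open>\<omega> x * \<omega> (inv x)\<close> unchanged, so the same
    \<open>c\<close> appears.\<close>
  moreover have "c * of_nat (m\<^sup>2) \<in> \<nat>"
    using K.trace_norm_average_nat[OF _ representation_subgroup[OF rep(2) sub]] finH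
    by (simp add: m_inv_consistent[OF sub] \<sigma> \<sigma>_inv c_def power2_eq_square ac_simps
        sum_distrib_left[symmetric] cong: sum.cong)
  ultimately have "c \<in> \<nat>"
    using coprime_squares_multiple_nat[OF cop pos(1)] by blast
  then obtain k where k: "c = of_nat k" by (rule Nats_cases)
  have "norm (\<Sum>x\<in>H. \<omega> x * \<omega> (inv x)) \<le> of_nat (card H)"
    using sum_norm_le[of H "\<lambda>x. \<omega> x * \<omega> (inv x)" "\<lambda>_. 1"] norm_prod by simp
  then have "k \<le> 1"
    unfolding cH k using cardH by (simp add: norm_mult)
  \<comment> \<open>The sum in \<open>nz\<close> is \<open>n * m\<close> times the sum defining
    \<open>c\<close>, so it would vanish together with \<open>k\<close>.\<close>
  moreover have "k \<noteq> 0"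
  proof
    assume "k = 0"
    then have "(\<Sum>x\<in>H. \<omega> x * \<omega> (inv x)) = 0"
      using cH k by simp
    moreover have "(\<Sum>x\<in>H. mat_trace (\<rho> x) * mat_trace (\<sigma> x)) =
        of_nat n * of_nat m * (\<Sum>x\<in>H. \<omega> x * \<omega> (inv x))"
      unfolding sum_distrib_left by (intro sum.cong) (simp_all add: \<rho> \<sigma>)
    ultimately show False using nz by simp
  qed
  ultimately have "c = 1" using k by (simp add: le_Suc_eq)
  then have "\<omega> y * \<omega> (inv y) = 1"
    using sum_eq_card_imp_all_1[OF finH norm_prod _ y] cH by simp
  then show ?thesis
    using y by (simp add: \<rho> \<sigma> ac_simps)
qed

subsection \<open>Constituents of the product\<close>

text \<open>The kernel \<open>H\<close> of \<alpha> is normal, so only the nonvanishing sum over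
  \<open>H\<close> has to be established. There \<alpha> is constantly its positive degree, while
  the rest of the product contributes a natural number, so nothing can cancel.\<close>

lemma char_kernel_constituent_subset:
  assumes fin: "finite (carrier G)" and irr: "\<chi> \<in> Irr G" "\<psi> \<in> Irr G"
    and cop: "coprime (char_degree G \<chi>) (char_degree G \<psi>)"
    and con: "\<alpha> \<in> irreducible_constituents G (\<lambda>g. \<chi> g * \<psi> g)"
  shows "char_kernel G \<alpha> \<subseteq> char_kernel G (\<lambda>g. \<chi> g * \<psi> g)"
proof -
  obtain n \<rho> where irr\<rho>: "irreducible_representation G n \<rho>" and \<chi>: "\<chi> = afforded_character G \<rho>"
    using irr(1) unfolding Irr_def by blast
  obtain m \<sigma> where irr\<sigma>: "irreducible_representation G m \<sigma>" and \<psi>: "\<psi> = afforded_character G \<sigma>"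
    using irr(2) unfolding Irr_def by blast
  have "\<alpha> \<in> Irr G"
    using con by (simp add: irreducible_constituents_def)
  then obtain d \<tau> where irr\<tau>: "irreducible_representation G d \<tau>" and \<alpha>: "\<alpha> = afforded_character G \<tau>"
    unfolding Irr_def by blast
  have rep: "representation G n \<rho>" "representation G m \<sigma>" "representation G d \<tau>"
    using irr\<rho> irr\<sigma> irr\<tau> by (simp_all add: irreducible_representation_def)
  note R = representationD[OF rep(1)] and S = representationD[OF rep(2)] and D = representationD[OF rep(3)]
  have \<chi>1: "\<chi> \<one> = of_nat n" and \<psi>1: "\<psi> \<one> = of_nat m" and \<alpha>1: "\<alpha> \<one> = of_nat d"
    by (simp_all add: \<chi> \<psi> \<alpha> afforded_character_def R(4) S(4) D(4) mat_trace_one)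
  have "char_degree G \<chi> = n" "char_degree G \<psi> = m"
    by (simp_all add: char_degree_def \<chi>1 \<psi>1)
  then have nm: "coprime n m"
    using cop by simp
  define H where "H = char_kernel G \<alpha>"
  have "\<alpha> \<in> characters G" using \<open>\<alpha> \<in> Irr G\<close> Irr_subset_characters by blast
  then have subH: "subgroup H G"
    unfolding H_def by (rule subgroup_char_kernel[OF fin])
  have H_iff: "H = {x \<in> carrier G. \<tau> x = 1\<^sub>m d}"
    unfolding H_def \<alpha> by (rule char_kernel_afforded_character[OF fin rep(3)])
  have norH: "H \<lhd> G"
    unfolding normal_inv_iff
  proof (intro conjI ballI subH)
    fix x h assume x: "x \<in> carrier G" and h: "h \<in> H"
    then have "\<tau> (x \<otimes> h \<otimes> inv x) = \<tau> x * \<tau> (inv x)"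
      using H_iff D(2,3) by (simp add: right_mult_one_mat[of _ d d])
    also have "\<dots> = 1\<^sub>m d"
      using x D(3)[of x "inv x"] D(4) by simp
    finally show "x \<otimes> h \<otimes> inv x \<in> H"
      using x h H_iff by simp
  qed
  have HG: "H \<subseteq> carrier G" and finH: "finite H" and "\<one> \<in> H"
    using subH fin by (auto dest: subgroup.subset subgroup.one_closed finite_subset)
  then have cardH: "card H > 0" by (auto simp: card_gt_0_iff)
  have \<chi>\<psi>: "\<chi> x * \<psi> x = mat_trace (\<rho> x) * mat_trace (\<sigma> x)" if "x \<in> H" for x
    using that HG by (auto simp: \<chi> \<psi> afforded_character_def)
  have sum_\<alpha>: "(\<Sum>x\<in>H. \<alpha> x) = of_nat (card H * d)"
    using \<alpha>1 by (simp add: H_def char_kernel_def)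
  \<comment> \<open>Representations have positive degree, so the zero function is not a character;
    the constituent that exhausts the product is treated separately.\<close>
  obtain k where k: "(\<Sum>x\<in>H. \<chi> x * \<psi> x - \<alpha> x) = of_nat k"
  proof (cases "(\<lambda>g. \<chi> g * \<psi> g) = \<alpha>")
    case True
    then have "(\<Sum>x\<in>H. \<chi> x * \<psi> x - \<alpha> x) = of_nat 0"
      by (simp add: fun_eq_iff)
    then show ?thesis by (rule that)
  next
    case False
    then have "(\<lambda>g. \<chi> g * \<psi> g - \<alpha> g) \<in> characters G"
      using con by (auto simp: irreducible_constituents_def)
    then obtain e \<upsilon> where rep\<upsilon>: "representation G e \<upsilon>"
      and \<upsilon>: "(\<lambda>g. \<chi> g * \<psi> g - \<alpha> g) = afforded_character G \<upsilon>"
      unfolding characters_def by blast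
    interpret HH: group "G\<lparr>carrier := H\<rparr>" by (rule subgroup_imp_group[OF subH])
    have "(\<Sum>x\<in>H. \<chi> x * \<psi> x - \<alpha> x) = (\<Sum>x\<in>H. mat_trace (\<upsilon> x))"
      using HG by (intro sum.cong) (auto simp: fun_cong[OF \<upsilon>] afforded_character_def)
    moreover have "(\<Sum>x\<in>H. mat_trace (\<upsilon> x)) / of_nat (card H) \<in> \<nat>"
      using HH.trace_average_nat[OF _ representation_subgroup[OF rep\<upsilon> subH]] finH by simp
    ultimately obtain l where "(\<Sum>x\<in>H. \<chi> x * \<psi> x - \<alpha> x) / of_nat (card H) = of_nat l"
      by (auto elim: Nats_cases)
    then have "(\<Sum>x\<in>H. \<chi> x * \<psi> x - \<alpha> x) = of_nat (l * card H)"
      using cardH by (simp add: field_simps)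
    then show ?thesis by (rule that)
  qed
  have "(\<Sum>x\<in>H. mat_trace (\<rho> x) * mat_trace (\<sigma> x)) = of_nat (k + card H * d)"
    using k sum_\<alpha> \<chi>\<psi> by (simp add: sum_subtractf algebra_simps)
  also have "\<dots> \<noteq> 0"
    using cardH D(1) by (simp only: of_nat_eq_0_iff) simp
  finally have nz: "(\<Sum>x\<in>H. mat_trace (\<rho> x) * mat_trace (\<sigma> x)) \<noteq> 0" .
  have "x \<in> char_kernel G (\<lambda>g. \<chi> g * \<psi> g)" if "x \<in> H" for x
    using trace_product_on_normal_subgroup[OF fin norH irr\<rho> irr\<sigma> nm nz that] \<chi>\<psi>[OF that] \<chi>1 \<psi>1 that HG
    by (auto simp: char_kernel_def)
  then show ?thesis
    unfolding H_def by blast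
qed

text \<open>The tensor product affords the pointwise product. This is what makes the kernel of the
  product a subgroup.\<close>

lemma characters_mult:
  assumes "\<chi> \<in> characters G" "\<psi> \<in> characters G"
  shows "(\<lambda>g. \<chi> g * \<psi> g) \<in> characters G"
proof -
  obtain n \<rho> m \<sigma> where rep: "representation G n \<rho>" "representation G m \<sigma>"
    and \<chi>: "\<chi> = afforded_character G \<rho>" and \<psi>: "\<psi> = afforded_character G \<sigma>"
    using assms unfolding characters_def by blast
  have "(\<lambda>g. \<chi> g * \<psi> g) = afforded_character G (\<lambda>x. kronecker (\<rho> x) (\<sigma> x))"
    using representationD(2)[OF rep(1)] representationD(2)[OF rep(2)]
    by (auto simp: fun_eq_iff \<chi> \<psi> afforded_character_def mat_trace_kronecker[of _ n _ m])
  then show ?thesis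
    using representation_kronecker[OF rep] unfolding characters_def by blast
qed

end

section \<open>Triviality of the quotient and its derived length\<close>

text \<open>The derived series of a one-element group is already trivial at index 0.\<close>

lemma derived_length_trivial:
  assumes "carrier G = {\<one>\<^bsub>G\<^esub>}"
  shows "derived_length G = 0"
proof -
  have "0 \<in> {n. (derived G ^^ n) (carrier G) = {\<one>\<^bsub>G\<^esub>}}"
    using assms by simp
  then have "derived_length G \<le> enat 0"
    unfolding derived_length_def by (rule INF_lower)
  then show ?thesis by (simp add: zero_enat_def[symmetric])
qed

theorem theoremB:
  fixes G :: "('a, 'b) monoid_scheme" and \<chi> \<psi> \<alpha> :: "'a \<Rightarrow> complex"
  assumes "group G" and "finite (carrier G)"
    and "\<chi> \<in> Irr G" and "\<psi> \<in> Irr G"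
    and "gcd (char_degree G \<chi>) (char_degree G \<psi>) = 1"
    and "\<alpha> \<in> irreducible_constituents G (\<lambda>g. \<chi> g * \<psi> g)"
  shows "derived_length
           (G\<lparr>carrier := char_kernel G \<alpha>\<rparr> Mod char_kernel G (\<lambda>g. \<chi> g * \<psi> g)) \<le> 1"
proof -
  interpret group G by fact
  define H where "H = char_kernel G \<alpha>"
  define K where "K = char_kernel G (\<lambda>g. \<chi> g * \<psi> g)"
  have HK: "H \<subseteq> K"
    unfolding H_def K_def using assms(2-6) by (intro char_kernel_constituent_subset) (auto simp: coprime_iff_gcd_eq_1)
  have subK: "subgroup K G"
    unfolding K_def using assms(2-4) Irr_subset_characters by (intro subgroup_char_kernel characters_mult) auto
  \<comment> \<open>Each representative from \<open>H\<close> lies in \<open>K\<close>, so its coset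
    is \<open>K\<close> itself and the quotient has a single element.\<close>
  have "K #>\<^bsub>G\<^esub> x = K" if "x \<in> H" for x
    using that HK coset_join2[OF _ subK] subgroup.mem_carrier[OF subK] by blast
  moreover have "\<one>\<^bsub>G\<^esub> \<in> H"
    by (simp add: H_def char_kernel_def)
  ultimately have "carrier (G\<lparr>carrier := H\<rparr> Mod K) = {K}"
    by (auto simp: FactGroup_def RCOSETS_def r_coset_def)
  then have "derived_length (G\<lparr>carrier := H\<rparr> Mod K) = 0"
    by (intro derived_length_trivial) (simp add: FactGroup_def)
  then show ?thesis
    by (simp add: H_def K_def)
qed

end
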